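(* Let $m,t\ge2$ be integers, $q\ge2$, and let $\mathcal C=\{\mathbf c^1,\dots,\mathbf c^m\}\subseteq Q^n$ be a code of size $m$. Then $\mathcal C$ is a wide-sense $t$-frameproof code if and only if for each $i\in[m]$ the family $\overline{\mathcal X_i}$ is a $(t-1)$-cover-free family of size $m-1$.
   Context: Let $Q=\{0,1,\dots,q-1\}$. For a nonempty set $X=\{\mathbf c^1,\dots,\mathbf c^s\}\subseteq Q^n$, a position $i\in[n]$ is undetectable for $X$ if $c^1_i=\dots=c^s_i$; let $U(X)$ be the set of undetectable positions and $\mathrm{wdesc}(X)=\{\mathbf y\in Q^n: y_i=c^1_i \text{ for all } i\in U(X)\}$. A code $\mathcal C\subseteq Q^n$ is a wide-sense $t$-frameproof code if $\mathrm{wdesc}(X)\cap\mathcal C=X$ for every nonempty $X\subseteq\mathcal C$ with $|X|\le t$. For distinct $i,j\in[m]$, $I(i,j)=\{k\in[n]: c^i_k=c^j_k\}$, and $\mathcal X_i=\{I(i,j): j\in[m]\setminus\{i\}\}\subseteq2^{[n]}$ (a set, so repeated sets count once). For $A\subseteq[n]$, $\overline A=[n]\setminus A$, and $\overline{\mathcal F}=\{\overline A:A\in\mathcal F\}$. A family $\mathcal F$ is $r$-cover-free if $A_0\not\subseteq A_1\cup\dots\cup A_s$ for all distinct $A_0,A_1,\dots,A_s\in\mathcal F$ with $s\le r$. *)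

theory Defs
  imports Main "HOL-Library.FuncSet"
begin

text \<open>Words over \<open>Q = {0, \<dots>, q - 1}\<close> of length \<open>n\<close> are the functions on the positions
  \<open>{1..n}\<close>, made \<open>undefined\<close> elsewhere so that equality of words is equality of functions.\<close>

definition words :: "nat \<Rightarrow> nat \<Rightarrow> (nat \<Rightarrow> nat) set" where
  "words q n = {1..n} \<rightarrow>\<^sub>E {0..<q}"

definition undetectable :: "nat \<Rightarrow> (nat \<Rightarrow> nat) set \<Rightarrow> nat set" where
  "undetectable n X = {i \<in> {1..n}. \<forall>c\<in>X. \<forall>d\<in>X. c i = d i}"

text \<open>On an undetectable position all members of \<open>X\<close> agree, so for nonempty \<open>X\<close> comparing with
  every member is the same as comparing with any chosen one.\<close>

definition wdesc :: "nat \<Rightarrow> nat \<Rightarrow> (nat \<Rightarrow> nat) set \<Rightarrow> (nat \<Rightarrow> nat) set" where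
  "wdesc q n X = {y \<in> words q n. \<forall>i\<in>undetectable n X. \<forall>c\<in>X. y i = c i}"

text \<open>Here \<open>X\<close> is automatically finite, being a subset of the finite set \<open>words q n\<close>.\<close>

definition wide_sense_frameproof :: "nat \<Rightarrow> nat \<Rightarrow> nat \<Rightarrow> (nat \<Rightarrow> nat) set \<Rightarrow> bool" where
  "wide_sense_frameproof q n t C \<longleftrightarrow>
     C \<subseteq> words q n \<and>
     (\<forall>X. X \<subseteq> C \<and> X \<noteq> {} \<and> card X \<le> t \<longrightarrow> wdesc q n X \<inter> C = X)"

definition agree :: "nat \<Rightarrow> (nat \<Rightarrow> nat \<Rightarrow> nat) \<Rightarrow> nat \<Rightarrow> nat \<Rightarrow> nat set" where
  "agree n c i j = {k \<in> {1..n}. c i k = c j k}"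

definition agree_family :: "nat \<Rightarrow> nat \<Rightarrow> (nat \<Rightarrow> nat \<Rightarrow> nat) \<Rightarrow> nat \<Rightarrow> nat set set" where
  "agree_family n m c i = {agree n c i j | j. j \<in> {1..m} - {i}}"

definition complement_family :: "nat \<Rightarrow> nat set set \<Rightarrow> nat set set" where
  "complement_family n F = {{1..n} - A | A. A \<in> F}"

text \<open>The set \<open>G\<close> collects the distinct covering members \<open>A\<^sub>1, \<dots>, A\<^sub>s\<close>, all different from
  \<open>A\<^sub>0\<close>, with \<open>1 \<le> s \<le> r\<close>.\<close>

definition cover_free :: "nat \<Rightarrow> 'a set set \<Rightarrow> bool" where
  "cover_free r F \<longleftrightarrow>
     (\<forall>A\<^sub>0\<in>F. \<forall>G. G \<subseteq> F - {A\<^sub>0} \<and> finite G \<and> G \<noteq> {} \<and> card G \<le> r \<longrightarrow> \<not> A\<^sub>0 \<subseteq> \<Union>G)"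

end

theory Submission
  imports Defs
begin

text \<open>Fix a codeword \<open>x\<close> and let \<open>D y\<close> be the set of positions where \<open>y\<close> differs from \<open>x\<close>. A word
  \<open>y\<close> is a wide-sense descendant of \<open>{x} \<union> Y\<close> iff \<open>D y\<close> is covered by the sets \<open>D z\<close> with
  \<open>z \<in> Y\<close>. Hence the frameproof property says that no \<open>D y\<close> is covered by at most \<open>t - 1\<close> other
  sets \<open>D z\<close>; the case of one covering set (this uses \<open>t \<ge> 2\<close>) makes \<open>D\<close> injective on the other
  codewords.\<close>

definition differ :: "nat \<Rightarrow> (nat \<Rightarrow> nat) \<Rightarrow> (nat \<Rightarrow> nat) \<Rightarrow> nat set" where
  "differ n x y = {k \<in> {1..n}. x k \<noteq> y k}"

lemma finite_words: "finite (words q n)"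
  unfolding words_def by (intro finite_PiE) auto

lemma differ_empty_iff:
  assumes "x \<in> words q n" "y \<in> words q n"
  shows "differ n x y = {} \<longleftrightarrow> x = y"
  using assms unfolding differ_def words_def by (auto intro: PiE_ext)

lemma subset_wdesc: "X \<subseteq> words q n \<Longrightarrow> X \<subseteq> wdesc q n X"
  unfolding wdesc_def undetectable_def by blast

text \<open>Pairwise agreement on \<open>insert x Y\<close> amounts to agreement with
  \<open>x\<close>, so a position is detectable iff some \<open>z\<close> in \<open>Y\<close>
  differs from \<open>x\<close> there. The condition on \<open>y\<close> is then
  contraposed.\<close>

lemma wdesc_insert_iff:
  "y \<in> wdesc q n (insert x Y) \<longleftrightarrow>
     y \<in> words q n \<and> differ n x y \<subseteq> (\<Union>z\<in>Y. differ n x z)"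
proof -
  have "k \<in> undetectable n (insert x Y) \<longleftrightarrow> k \<in> {1..n} \<and> (\<forall>z\<in>Y. x k = z k)" for k
    unfolding undetectable_def by auto metis
  then have "(\<forall>k\<in>undetectable n (insert x Y). \<forall>z\<in>insert x Y. y k = z k) \<longleftrightarrow>
      (\<forall>k\<in>{1..n}. (\<forall>z\<in>Y. x k = z k) \<longrightarrow> x k = y k)"
    by auto
  also have "\<dots> \<longleftrightarrow> differ n x y \<subseteq> (\<Union>z\<in>Y. differ n x z)"
    unfolding differ_def by auto
  finally show ?thesis
    unfolding wdesc_def by simp
qed

text \<open>Splitting a base word \<open>x\<close> off from \<open>X = insert x Y\<close> turns the
  bound \<open>t\<close> into \<open>t - 1\<close>. The case \<open>Y = {}\<close>, that is
  \<open>X = {x}\<close>, is included.\<close>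

lemma wide_sense_frameproof_iff_not_covered:
  assumes C: "C \<subseteq> words q n" and t: "t \<ge> 1"
  shows "wide_sense_frameproof q n t C \<longleftrightarrow>
    (\<forall>x\<in>C. \<forall>y\<in>C - {x}. \<forall>Y. Y \<subseteq> C - {x, y} \<and> card Y \<le> t - 1 \<longrightarrow>
       \<not> differ n x y \<subseteq> (\<Union>z\<in>Y. differ n x z))"
    (is "_ \<longleftrightarrow> ?R")
proof
  assume F: "wide_sense_frameproof q n t C"
  show ?R
  proof (intro ballI allI impI notI)
    fix x y Y
    assume x: "x \<in> C" and y: "y \<in> C - {x}"
      and Y: "Y \<subseteq> C - {x, y} \<and> card Y \<le> t - 1"
      and cov: "differ n x y \<subseteq> (\<Union>z\<in>Y. differ n x z)"
    have "card (insert x Y) \<le> t"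
      using card_insert_le_m1[of t Y x] t Y by simp
    moreover have "insert x Y \<subseteq> C"
      using x Y by blast
    ultimately have "wdesc q n (insert x Y) \<inter> C = insert x Y"
      using F unfolding wide_sense_frameproof_def by blast
    moreover have "y \<in> wdesc q n (insert x Y)"
      using cov y C by (auto simp: wdesc_insert_iff)
    ultimately show False
      using y Y by blast
  qed
next
  assume R: ?R
  show "wide_sense_frameproof q n t C"
    unfolding wide_sense_frameproof_def
  proof (intro conjI allI impI C)
    fix X
    assume X: "X \<subseteq> C \<and> X \<noteq> {} \<and> card X \<le> t"
    then obtain x where x: "x \<in> X" by blast
    have finX: "finite X"
      using X C finite_words by (metis finite_subset)
    have "y \<in> X" if y: "y \<in> wdesc q n X" "y \<in> C" for y
    proof (rule ccontr)
      assume "y \<notin> X"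
      moreover have "differ n x y \<subseteq> (\<Union>z\<in>X - {x}. differ n x z)"
        using y x wdesc_insert_iff[of y q n x "X - {x}"] by (simp add: insert_absorb)
      moreover have "card (X - {x}) \<le> t - 1"
        using X x finX by (simp add: diff_le_mono)
      ultimately show False
        using R[rule_format, of x y "X - {x}"] X x y by blast
    qed
    then show "wdesc q n X \<inter> C = X"
      using subset_wdesc[of X q n] X C by blast
  qed
qed

text \<open>Coverings by words become coverings by distinct sets; injectivity records what is lost
  when two words have the same difference set.\<close>

lemma wide_sense_frameproof_iff_cover_free:
  assumes C: "C \<subseteq> words q n" and t: "t \<ge> 2"
  shows "wide_sense_frameproof q n t C \<longleftrightarrow>
    (\<forall>x\<in>C. inj_on (differ n x) (C - {x}) \<and> cover_free (t - 1) (differ n x ` (C - {x})))"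
    (is "_ \<longleftrightarrow> ?R")
proof -
  have finC: "finite C"
    using C finite_words by (rule finite_subset)
  have t1: "t \<ge> 1" using t by simp
  show ?thesis
    unfolding wide_sense_frameproof_iff_not_covered[OF C t1]
  proof (intro iffI ballI conjI)
    fix x
    assume "\<forall>x\<in>C. \<forall>y\<in>C - {x}. \<forall>Y. Y \<subseteq> C - {x, y} \<and> card Y \<le> t - 1 \<longrightarrow>
              \<not> differ n x y \<subseteq> (\<Union>z\<in>Y. differ n x z)"
      and "x \<in> C"
    then have nc: "\<not> differ n x y \<subseteq> (\<Union>z\<in>Y. differ n x z)"
      if "y \<in> C - {x}" "Y \<subseteq> C - {x, y}" "card Y \<le> t - 1" for y Y
      using that by blast
    show "inj_on (differ n x) (C - {x})"
    proof (rule inj_onI, rule ccontr)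
      fix y z
      assume "y \<in> C - {x}" "z \<in> C - {x}" "differ n x y = differ n x z" "y \<noteq> z"
      \<comment> \<open>This is where \<open>t \<ge> 2\<close> enters: a single covering word must
        be allowed.\<close>
      moreover have "card {z} \<le> t - 1"
        using t by simp
      ultimately show False
        using nc[of y "{z}"] by blast
    qed
    show "cover_free (t - 1) (differ n x ` (C - {x}))"
      unfolding cover_free_def
    proof (intro ballI allI impI)
      fix A G
      assume "A \<in> differ n x ` (C - {x})"
        and G: "G \<subseteq> differ n x ` (C - {x}) - {A} \<and> finite G \<and> G \<noteq> {} \<and> card G \<le> t - 1"
      then obtain y where y: "y \<in> C - {x}" "A = differ n x y" by blast
      have "G \<subseteq> differ n x ` (C - {x})"
        using G by blast
      \<comment> \<open>One preimage is chosen for each member of \<open>G\<close>, so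
        \<open>Y\<close> is no larger than \<open>G\<close>; \<open>y\<close> is not in
        \<open>Y\<close> because \<open>A\<close> is not in \<open>G\<close>.\<close>
      then obtain Y where Y: "Y \<subseteq> C - {x}" "inj_on (differ n x) Y" "G = differ n x ` Y"
        by (rule subset_image_inj[THEN iffD1, THEN exE]) blast
      have "card Y \<le> t - 1"
        using G Y by (simp add: card_image)
      moreover have "Y \<subseteq> C - {x, y}"
        using Y G y by blast
      ultimately show "\<not> A \<subseteq> \<Union>G"
        using nc[of y Y] y Y by simp
    qed
  next
    fix x y
    assume R: ?R and x: "x \<in> C" and y: "y \<in> C - {x}"
    show "\<forall>Y. Y \<subseteq> C - {x, y} \<and> card Y \<le> t - 1 \<longrightarrow>
            \<not> differ n x y \<subseteq> (\<Union>z\<in>Y. differ n x z)"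
    proof (intro allI impI)
      fix Y
      assume Y: "Y \<subseteq> C - {x, y} \<and> card Y \<le> t - 1"
      show "\<not> differ n x y \<subseteq> (\<Union>z\<in>Y. differ n x z)"
      proof (cases "Y = {}")
        \<comment> \<open>\<open>cover_free\<close> speaks only of nonempty \<open>G\<close>; here
          \<open>differ n x y\<close> is nonempty because \<open>x\<close> and \<open>y\<close> are
          distinct words.\<close>
        case True
        then show ?thesis
          using differ_empty_iff[of x q n y] x y C by auto
      next
        case False
        have inj: "inj_on (differ n x) (C - {x})"
          and cf: "cover_free (t - 1) (differ n x ` (C - {x}))"
          using R x by blast+
        have finY: "finite Y"
          using Y finC by (meson finite_Diff finite_subset)
        \<comment> \<open>Without injectivity some \<open>z\<close> in \<open>Y\<close> could have
          the same difference set as \<open>y\<close>.\<close>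
        have "differ n x ` Y \<subseteq> differ n x ` (C - {x}) - {differ n x y}"
          using Y y inj by (auto dest: inj_onD)
        moreover have "card (differ n x ` Y) \<le> t - 1"
          using card_image_le[OF finY, of "differ n x"] Y by linarith
        ultimately show ?thesis
          using cf y False finY unfolding cover_free_def by simp
      qed
    qed
  qed
qed

text \<open>Complementing agreement gives difference; injectivity of \<open>c\<close> lets removal
  of the index \<open>i\<close> become removal of the word \<open>c i\<close>.\<close>

lemma complement_agree_family:
  assumes "inj_on c {1..m}" "i \<in> {1..m}"
  shows "complement_family n (agree_family n m c i) = differ n (c i) ` (c ` {1..m} - {c i})"
proof -
  have compl: "{1..n} - agree n c i j = differ n (c i) (c j)" for j
    unfolding agree_def differ_def by auto
  have "complement_family n (agree_family n m c i) =
      (\<lambda>j. {1..n} - agree n c i j) ` ({1..m} - {i})"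
    unfolding complement_family_def agree_family_def by blast
  also have "\<dots> = differ n (c i) ` c ` ({1..m} - {i})"
    by (simp only: compl image_image)
  also have "c ` ({1..m} - {i}) = c ` {1..m} - {c i}"
    using assms by (auto dest: inj_onD)
  finally show ?thesis .
qed

theorem theorem4p1:
  fixes m t q n :: nat
    and c :: "nat \<Rightarrow> nat \<Rightarrow> nat"
    and C :: "(nat \<Rightarrow> nat) set"
  assumes "m \<ge> 2" and "t \<ge> 2" and "q \<ge> 2"
    and "C = c ` {1..m}" and "C \<subseteq> words q n" and "card C = m"
  shows "wide_sense_frameproof q n t C \<longleftrightarrow>
    (\<forall>i\<in>{1..m}.
       cover_free (t - 1) (complement_family n (agree_family n m c i)) \<and>
       card (complement_family n (agree_family n m c i)) = m - 1)"
proof -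
  have inj: "inj_on c {1..m}"
    using assms(4,6) by (intro eq_card_imp_inj_on) auto
  have finC: "finite C"
    using assms(4) by simp
  \<comment> \<open>As \<open>C - {x}\<close> has \<open>m - 1\<close> elements, the size condition
    on the family is exactly injectivity.\<close>
  have "card (differ n x ` (C - {x})) = m - 1 \<longleftrightarrow> inj_on (differ n x) (C - {x})"
    if "x \<in> C" for x
    using that finC assms(6) by (simp add: inj_on_iff_eq_card)
  then show ?thesis
    using wide_sense_frameproof_iff_cover_free[OF assms(5,2)]
      complement_agree_family[OF inj, of _ n] assms(4)
    by auto
qed

end
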